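(* Let $f(x)=\tfrac12x^THx+\zeta^Tx$ with $H\in\mathbb{S}_{++}^n$ and $\zeta\in\mathbb{R}^n$, let $h:\mathbb{R}^n\to\mathbb{R}\cup\{\infty\}$ be proper, closed and convex, let $A\in\mathbb{R}^{m\times n}$ have full row rank, let $B\in\mathbb{R}^{p\times n}$, $b\in\mathbb{R}^m$, and put $C=[A^T~B^T]^T\in\mathbb{R}^{(m+p)\times n}$, $c=(b,0)\in\mathbb{R}^{m+p}$, $F=f+h$, $d(\nu)=-F^\star(-C^T\nu)-c^T\nu$ and $x^\star(\nu)=\arg\min_x\{F(x)+\nu^TCx\}$ for $\nu\in\mathbb{R}^{m+p}$. Assume that there exists a set $\mathcal{X}\subseteq\mathbb{R}^n$ with non-empty interior on which $h$ is linear, i.e. there are $\xi_{\mathcal{X}}\in\mathbb{R}^n$ and $\theta_{\mathcal{X}}\in\mathbb{R}$ with $h(x)=\xi_{\mathcal{X}}^Tx+\theta_{\mathcal{X}}$ for all $x\in\mathcal{X}$. Further assume that there exists $\widetilde{\nu}\in\mathbb{R}^{m+p}$ such that $x^\star(\widetilde{\nu})\in\mathrm{int}(\mathcal{X})$. Then for any symmetric matrix $\mathbf{L}\in\mathbb{R}^{(m+p)\times(m+p)}$ with $\mathbf{L}\not\succeq CH^{-1}C^T$, there exist $\nu_1,\nu_2\in\mathbb{R}^{m+p}$ such that the inequality $$d(\nu_1)\ge d(\nu_2)+\langle\nabla d(\nu_2),\nu_1-\nu_2\rangle-\tfrac12\|\nu_1-\nu_2\|_{\mathbf{L}}^2$$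 does not hold.
   Context: $\mathbb{S}_{++}^n$ is the set of symmetric positive definite real $n\times n$ matrices; $L\succeq M$ means $L-M$ is symmetric positive semidefinite, and $\not\succeq$ is its negation; $\|v\|_{\mathbf{L}}^2:=v^T\mathbf{L}v$. The conjugate of $F$ is $F^\star(y)=\sup_x\{y^Tx-F(x)\}$. Under the stated assumptions $x^\star(\nu)$ is well defined and $d$ is differentiable on $\mathbb{R}^{m+p}$. *)

theory Defs
  imports "HOL-Analysis.Analysis"
begin

definition sym_mat :: "real ^ 'n ^ 'n \<Rightarrow> bool" where
  "sym_mat M \<longleftrightarrow> transpose M = M"

definition pos_def :: "real ^ 'n ^ 'n \<Rightarrow> bool" where
  "pos_def M \<longleftrightarrow> sym_mat M \<and> (\<forall>v. v \<noteq> 0 \<longrightarrow> v \<bullet> (M *v v) > 0)"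

definition pos_semidef :: "real ^ 'n ^ 'n \<Rightarrow> bool" where
  "pos_semidef M \<longleftrightarrow> sym_mat M \<and> (\<forall>v. v \<bullet> (M *v v) \<ge> 0)"

definition loewner_ge :: "real ^ 'n ^ 'n \<Rightarrow> real ^ 'n ^ 'n \<Rightarrow> bool"  (infix \<open>\<succeq>\<close> 50) where
  "L \<succeq> M \<longleftrightarrow> pos_semidef (L - M)"

definition norm_sq_mat :: "real ^ 'n ^ 'n \<Rightarrow> real ^ 'n \<Rightarrow> real" where
  "norm_sq_mat L v = v \<bullet> (L *v v)"

definition stack_mat :: "real ^ 'n ^ 'm \<Rightarrow> real ^ 'n ^ 'p \<Rightarrow> real ^ 'n ^ ('m + 'p)" where
  "stack_mat A B = (\<chi> i. case i of Inl j \<Rightarrow> A $ j | Inr k \<Rightarrow> B $ k)"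

definition stack_vec :: "real ^ 'm \<Rightarrow> real ^ 'p \<Rightarrow> real ^ ('m + 'p)" where
  "stack_vec u w = (\<chi> i. case i of Inl j \<Rightarrow> u $ j | Inr k \<Rightarrow> w $ k)"

definition ereal_epigraph :: "('a \<Rightarrow> ereal) \<Rightarrow> ('a \<times> real) set" where
  "ereal_epigraph h = {(x, t). h x \<le> ereal t}"

definition proper_fun :: "('a \<Rightarrow> ereal) \<Rightarrow> bool" where
  "proper_fun h \<longleftrightarrow> (\<forall>x. h x \<noteq> -\<infinity>) \<and> (\<exists>x. h x \<noteq> \<infinity>)"

definition closed_fun :: "('a::topological_space \<Rightarrow> ereal) \<Rightarrow> bool" where
  "closed_fun h \<longleftrightarrow> closed (ereal_epigraph h)"

definition convex_fun :: "('a::real_vector \<Rightarrow> ereal) \<Rightarrow> bool" where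
  "convex_fun h \<longleftrightarrow> convex (ereal_epigraph h)"

definition conjugate_fun :: "('a::real_inner \<Rightarrow> ereal) \<Rightarrow> 'a \<Rightarrow> ereal" where
  "conjugate_fun F y = (SUP x. ereal (y \<bullet> x) - F x)"

definition dual_fun ::
  "(real ^ 'n \<Rightarrow> ereal) \<Rightarrow> real ^ 'n ^ 'k \<Rightarrow> real ^ 'k \<Rightarrow> real ^ 'k \<Rightarrow> ereal" where
  "dual_fun F C c \<nu> = - conjugate_fun F (- (transpose C *v \<nu>)) - ereal (c \<bullet> \<nu>)"

definition primal_argmin ::
  "(real ^ 'n \<Rightarrow> ereal) \<Rightarrow> real ^ 'n ^ 'k \<Rightarrow> real ^ 'k \<Rightarrow> real ^ 'n" where
  "primal_argmin F C \<nu> = arg_min (\<lambda>x. F x + ereal (\<nu> \<bullet> (C *v x))) (\<lambda>_. True)"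

text \<open>
  Gradient of an extended-real-valued function.  Finiteness near the point is required because
  \<^const>\<open>real_of_ereal\<close> sends both infinities to \<open>0\<close>.
\<close>

definition has_gradient :: "('a::real_inner \<Rightarrow> ereal) \<Rightarrow> 'a \<Rightarrow> 'a \<Rightarrow> bool" where
  "has_gradient d x g \<longleftrightarrow>
     (\<forall>\<^sub>F z in nhds x. \<bar>d z\<bar> \<noteq> \<infinity>) \<and> (GDERIV (\<lambda>z. real_of_ereal (d z)) x :> g)"

definition gradient :: "('a::real_inner \<Rightarrow> ereal) \<Rightarrow> 'a \<Rightarrow> 'a" where
  "gradient d x = (THE g. has_gradient d x g)"

lemma has_gradient_unique:
  assumes "has_gradient d x g" and "has_gradient d x g'"
  shows "g = g'"
proof -
  have "((\<lambda>z. real_of_ereal (d z)) has_derivative (\<lambda>v. v \<bullet> g)) (at x)"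
    and "((\<lambda>z. real_of_ereal (d z)) has_derivative (\<lambda>v. v \<bullet> g')) (at x)"
    using assms by (simp_all add: has_gradient_def gderiv_def)
  then have "(\<lambda>v. v \<bullet> g) = (\<lambda>v. v \<bullet> g')"
    by (rule has_derivative_unique)
  then have "(g - g') \<bullet> g = (g - g') \<bullet> g'"
    by (rule fun_cong)
  then have "(g - g') \<bullet> (g - g') = 0"
    by (simp add: inner_diff_right)
  then show ?thesis
    by simp
qed

lemma gradient_eq:
  assumes "has_gradient d x g"
  shows "gradient d x = g"
  unfolding gradient_def
proof (rule the_equality)
  show "has_gradient d x g"
    by (rule assms)
  show "g' = g" if "has_gradient d x g'" for g'
    by (rule has_gradient_unique[OF that assms])
qed

end

theory Submission
  imports Defs
begin

text \<open>
  A convex function that is affine on a set with non-empty interior lies above that affine function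
  everywhere (\<open>convex_fun_ge_affine\<close>).  Hence \<open>F x + \<nu> \<bullet> (C *v x)\<close> is bounded below by a strictly convex quadratic,
  with equality on \<open>X\<close>, and the unconstrained minimiser of this quadratic depends
  affinely on \<open>\<nu>\<close>.  The quadratic is coercive and \<open>h\<close> is closed, so a minimiser of
  \<open>F x + \<nu>t \<bullet> (C *v x)\<close> exists and \<^const>\<open>primal_argmin\<close> really returns one;
  being interior to \<open>X\<close>, it must be the minimiser of the quadratic (\<open>primal_argmin_interior\<close>).  By continuity the
  minimiser of the quadratic stays in \<open>X\<close> for all \<open>\<nu>\<close> near \<open>\<nu>t\<close>, and there the dual
  function is obtained by minimising the quadratic explicitly
  (\<open>dual_fun_eq_quadratic\<close>): near \<open>\<nu>t\<close> it is itself a quadratic,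
  with Hessian \<open>- (C ** matrix_inv H ** transpose C)\<close>.

  If \<open>L \<succeq> C ** matrix_inv H ** transpose C\<close> fails, some direction \<open>v\<close> has strictly smaller
  curvature under \<open>L\<close> than under minus that Hessian.  As the second order expansion of \<open>d\<close>
  is exact near \<open>\<nu>t\<close>, a short step along \<open>v\<close> violates the claimed lower bound.
\<close>

section \<open>Positive definite matrices\<close>

text \<open>Adjoints are moved across inner products below, so \<open>transpose M *v x\<close> is the form to keep.\<close>

declare transpose_matrix_vector [simp del]

lemma inner_matrix_transpose:
  fixes M :: "real ^ 'n ^ 'm"
  shows "x \<bullet> (M *v y) = (transpose M *v x) \<bullet> y"
  by (simp add: dot_lmul_matrix transpose_matrix_vector)

lemma sym_mat_inner:
  assumes "sym_mat M"
  shows "(M *v x) \<bullet> y = x \<bullet> (M *v y)"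
  using assms inner_matrix_transpose[of x M y] by (simp add: sym_mat_def)

lemma pos_def_invertible:
  assumes "pos_def H"
  shows "invertible H"
proof -
  have "x = 0" if "H *v x = 0" for x
    using assms that by (force simp: pos_def_def)
  then obtain N where "N ** H = mat 1"
    using matrix_left_invertible_ker[of H] by blast
  then show ?thesis
    using invertible_left_inverse[of H] by blast
qed

lemma matrix_inv_inverse:
  assumes "invertible M"
  shows "M ** matrix_inv M = mat 1 \<and> matrix_inv M ** M = mat 1"
  using assms unfolding invertible_def matrix_inv_def by (rule someI_ex)

lemma pos_def_inverse_cancel:
  assumes "pos_def H"
  shows "H *v (matrix_inv H *v w) = w"
  using matrix_inv_inverse[OF pos_def_invertible[OF assms]]
  by (simp add: matrix_vector_mul_assoc)

lemma pos_def_inverse_sym: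
  assumes "pos_def H"
  shows "sym_mat (matrix_inv H)"
proof -
  let ?J = "matrix_inv H"
  have inv: "H ** ?J = mat 1" "?J ** H = mat 1"
    using matrix_inv_inverse[OF pos_def_invertible[OF assms]] by simp_all
  have "transpose ?J ** H = mat 1"
    using arg_cong[OF inv(1), of transpose] assms
    by (simp add: matrix_transpose_mul pos_def_def sym_mat_def)
  then have "transpose ?J = ?J"
    by (metis inv(1) matrix_mul_assoc matrix_mul_lid matrix_mul_rid)
  then show ?thesis
    by (simp add: sym_mat_def)
qed

text \<open>The constant is the minimum of the quadratic form over the compact unit sphere.\<close>

lemma pos_def_coercive:
  fixes H :: "real ^ 'n ^ 'n"
  assumes "pos_def H"
  obtains \<mu> where "\<mu> > 0" and "\<And>v. v \<bullet> (H *v v) \<ge> \<mu> * (norm v)\<^sup>2"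
proof -
  let ?Q = "\<lambda>v. v \<bullet> (H *v v)"
  have "continuous_on (sphere 0 1) ?Q"
    by (intro continuous_intros matrix_vector_mult_linear_continuous_on)
  moreover have "sphere (0 :: real ^ 'n) 1 \<noteq> {}"
    using vector_choose_size[of 1] by fastforce
  ultimately obtain u where u: "u \<in> sphere 0 1" and min: "\<And>v. v \<in> sphere 0 1 \<Longrightarrow> ?Q u \<le> ?Q v"
    using continuous_attains_inf[OF compact_sphere, of 0 1 ?Q] by blast
  have "?Q u > 0"
    using assms u by (cases "u = 0") (simp_all add: pos_def_def)
  moreover have "?Q v \<ge> ?Q u * (norm v)\<^sup>2" for v
  proof (cases "v = 0")
    case False
    define e where "e = v /\<^sub>R norm v"
    have v: "v = norm v *\<^sub>R e"
      using False by (simp add: e_def)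
    have "?Q (norm v *\<^sub>R e) = (norm v)\<^sup>2 * ?Q e"
      by (simp add: matrix_vector_mult_scaleR power2_eq_square)
    then have "?Q v = (norm v)\<^sup>2 * ?Q e"
      by (simp flip: v)
    moreover have "?Q u \<le> ?Q e"
      using False by (intro min) (simp add: e_def)
    ultimately show ?thesis
      by (simp add: mult.commute[of _ "(norm v)\<^sup>2"] mult_left_mono)
  qed simp
  ultimately show thesis
    by (rule that)
qed

text \<open>
  One identity yields the minimiser \<open>- (J *v w)\<close> of the quadratic, its minimum, and, through
  coercivity, the boundedness of its sublevel sets.
\<close>

lemma complete_the_square:
  assumes "pos_def H"
  defines "J \<equiv> matrix_inv H"
  shows "1 / 2 * (x \<bullet> (H *v x)) + w \<bullet> x
    = 1 / 2 * ((x + J *v w) \<bullet> (H *v (x + J *v w))) - 1 / 2 * (w \<bullet> (J *v w))"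
proof -
  have HJ: "H *v (J *v w) = w"
    unfolding J_def by (rule pos_def_inverse_cancel[OF assms(1)])
  have "(J *v w) \<bullet> (H *v x) = w \<bullet> x"
    using sym_mat_inner[of H "J *v w" x] assms(1) HJ by (simp add: pos_def_def)
  then show ?thesis
    by (simp add: matrix_vector_right_distrib HJ inner_add_left inner_add_right
        inner_commute[of x w] inner_commute[of "J *v w" w] add_divide_distrib)
qed

lemma pos_def_sublevel_bounded:
  fixes H :: "real ^ 'n ^ 'n"
  assumes "pos_def H"
  shows "bounded {x. 1 / 2 * (x \<bullet> (H *v x)) + w \<bullet> x \<le> \<alpha>}"
proof -
  let ?J = "matrix_inv H"
  obtain \<mu> where \<mu>: "\<mu> > 0" "\<And>v. v \<bullet> (H *v v) \<ge> \<mu> * (norm v)\<^sup>2"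
    using pos_def_coercive[OF assms] by blast
  define R where "R = (2 * \<alpha> + w \<bullet> (?J *v w)) / \<mu>"
  have "x \<in> cball (- (?J *v w)) (sqrt R)" if "1 / 2 * (x \<bullet> (H *v x)) + w \<bullet> x \<le> \<alpha>" for x
  proof -
    have "(x + ?J *v w) \<bullet> (H *v (x + ?J *v w)) \<le> 2 * \<alpha> + w \<bullet> (?J *v w)"
      using that complete_the_square[OF assms, of x w] by argo
    then have "\<mu> * (norm (x + ?J *v w))\<^sup>2 \<le> 2 * \<alpha> + w \<bullet> (?J *v w)"
      using \<mu>(2) order_trans by blast
    then have "(norm (x + ?J *v w))\<^sup>2 \<le> R"
      using \<mu>(1) by (simp add: R_def field_simps)
    then have "norm (x + ?J *v w) \<le> sqrt R"
      by (rule real_le_rsqrt)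
    then show ?thesis
      by (metis add.commute diff_minus_eq_add dist_norm dist_commute mem_cball)
  qed
  then show ?thesis
    by (intro bounded_subset[OF bounded_cball]) blast
qed

section \<open>Convex functions that are affine on a neighbourhood\<close>

lemma interior_small_step:
  fixes x y :: "'a::real_normed_vector"
  assumes "x \<in> interior X"
  obtains t where "0 < t" "t < 1" "x + t *\<^sub>R (y - x) \<in> X"
proof -
  obtain e where e: "e > 0" "ball x e \<subseteq> X"
    using assms mem_interior by blast
  have "((\<lambda>t. x + t *\<^sub>R (y - x)) \<longlongrightarrow> x + 0 *\<^sub>R (y - x)) (at_right (0::real))"
    by (intro tendsto_intros)
  then have "\<forall>\<^sub>F t in at_right 0. x + t *\<^sub>R (y - x) \<in> ball x e"
    using e(1) by (intro topological_tendstoD) auto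
  moreover have "\<forall>\<^sub>F t in at_right (0::real). 0 < t \<and> t < 1"
    by (auto simp: eventually_at_right_field intro: exI[of _ 1])
  ultimately have "\<forall>\<^sub>F t in at_right 0. x + t *\<^sub>R (y - x) \<in> ball x e \<and> 0 < t \<and> t < 1"
    by (rule eventually_conj)
  then obtain t where "x + t *\<^sub>R (y - x) \<in> ball x e" "0 < t" "t < 1"
    using eventually_happens trivial_limit_at_right_real by blast
  then show thesis
    using that e(2) by blast
qed

text \<open>
  A short step from \<open>x0\<close> towards \<open>x\<close> stays in \<open>X\<close>, where \<open>h\<close> is known; a value at \<open>x\<close> below the
  affine function would make the chord from \<open>x0\<close> to \<open>x\<close> fall below the graph there.
\<close>

lemma convex_fun_ge_affine:
  fixes h :: "'a::real_inner \<Rightarrow> ereal"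
  assumes "convex_fun h" and "x0 \<in> interior X"
    and aff: "\<And>x. x \<in> X \<Longrightarrow> h x = ereal (\<xi> \<bullet> x + \<theta>)"
  shows "ereal (\<xi> \<bullet> x + \<theta>) \<le> h x"
proof (rule ereal_le_real)
  fix r assume "h x \<le> ereal r"
  obtain t where t: "0 < t" "t < 1" "x0 + t *\<^sub>R (x - x0) \<in> X"
    using interior_small_step[OF assms(2)] .
  let ?E = "ereal_epigraph h"
  have "(x0, \<xi> \<bullet> x0 + \<theta>) \<in> ?E"
    using aff[of x0] assms(2) interior_subset[of X] by (auto simp: ereal_epigraph_def)
  moreover have "(x, r) \<in> ?E"
    using \<open>h x \<le> ereal r\<close> by (simp add: ereal_epigraph_def)
  ultimately have "(1 - t) *\<^sub>R (x0, \<xi> \<bullet> x0 + \<theta>) + t *\<^sub>R (x, r) \<in> ?E"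
    using assms(1) t by (intro convexD) (auto simp: convex_fun_def)
  moreover have "(1 - t) *\<^sub>R x0 + t *\<^sub>R x = x0 + t *\<^sub>R (x - x0)"
    by (simp add: algebra_simps)
  ultimately have "h (x0 + t *\<^sub>R (x - x0)) \<le> ereal ((1 - t) * (\<xi> \<bullet> x0 + \<theta>) + t * r)"
    by (simp add: ereal_epigraph_def)
  then have "\<xi> \<bullet> (x0 + t *\<^sub>R (x - x0)) + \<theta> \<le> (1 - t) * (\<xi> \<bullet> x0 + \<theta>) + t * r"
    using aff[OF t(3)] by simp
  then have "t * (\<xi> \<bullet> x + \<theta>) \<le> t * r"
    by (simp add: inner_diff_right inner_add_right algebra_simps)
  then show "ereal (\<xi> \<bullet> x + \<theta>) \<le> ereal r"
    using t(1) by simp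
qed

text \<open>
  The extended-real objective need not be continuous, so the continuous function \<open>q x + t\<close> is minimised
  instead, over the part of the epigraph of \<open>h\<close> where it is at most its value at a reference point;
  closedness of \<open>h\<close> and coercivity of the lower bound make this part compact.
\<close>

lemma closed_fun_attains_min:
  fixes h :: "'a::euclidean_space \<Rightarrow> ereal"
  assumes "closed_fun h"
    and contq: "continuous_on UNIV q" and contg: "continuous_on UNIV g"
    and lower: "\<And>x. ereal (g x) \<le> h x"
    and bnd: "\<And>\<alpha>. bounded {x. q x + g x \<le> \<alpha>}"
    and fin: "h x0 \<noteq> \<infinity>"
  shows "\<exists>x. \<forall>y. ereal (q x) + h x \<le> ereal (q y) + h y"
proof -
  obtain s0 where s0: "h x0 = ereal s0"
    using fin lower[of x0] by (cases "h x0") auto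
  define \<alpha> where "\<alpha> = q x0 + s0"
  define \<Phi> where "\<Phi> = (\<lambda>z :: 'a \<times> real. q (fst z) + snd z)"
  define E where "E = ereal_epigraph h \<inter> {z. \<Phi> z \<le> \<alpha>}"
  have cont: "continuous_on UNIV \<Phi>"
    unfolding \<Phi>_def by (intro continuous_intros continuous_on_compose2[OF contq]) auto
  have "closed E"
    unfolding E_def using assms(1) cont
    by (intro closed_Int closed_Collect_le) (auto simp: closed_fun_def intro: continuous_intros)
  moreover have "bounded E"
  proof -
    let ?K = "closure {x. q x + g x \<le> \<alpha>}"
    have K: "compact ?K"
      using bnd[of \<alpha>] by (simp add: compact_closure)
    have "bounded (g ` ?K)" "bounded ((\<lambda>x. \<alpha> - q x) ` ?K)"
      using K contq contg
      by (auto intro!: compact_imp_bounded compact_continuous_image continuous_intros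
          intro: continuous_on_subset)
    then obtain M N where MN: "\<forall>y \<in> g ` ?K. norm y \<le> M" "\<forall>y \<in> (\<lambda>x. \<alpha> - q x) ` ?K. norm y \<le> N"
      unfolding bounded_iff by blast
    have M: "\<bar>g x\<bar> \<le> M" and N: "\<bar>\<alpha> - q x\<bar> \<le> N" if "x \<in> ?K" for x
      using that MN by simp_all
    have "E \<subseteq> ?K \<times> {- M..N}"
    proof
      fix z assume "z \<in> E"
      then obtain x t where z: "z = (x, t)" "h x \<le> ereal t" "q x + t \<le> \<alpha>"
        by (cases z) (auto simp: E_def \<Phi>_def ereal_epigraph_def)
      have "g x \<le> t"
        using lower[of x] z(2) order_trans by fastforce
      moreover from this have x: "x \<in> ?K"
        using z(3) closure_subset by fastforce
      ultimately show "z \<in> ?K \<times> {- M..N}"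
        using M[OF x] N[OF x] z by auto
    qed
    then show ?thesis
      by (rule bounded_subset[rotated])
        (intro bounded_Times compact_imp_bounded[OF K] bounded_closed_interval)
  qed
  moreover have "(x0, s0) \<in> E"
    by (simp add: E_def ereal_epigraph_def s0 \<Phi>_def \<alpha>_def)
  ultimately obtain z where z: "z \<in> E" and min: "\<And>z'. z' \<in> E \<Longrightarrow> \<Phi> z \<le> \<Phi> z'"
    using continuous_attains_inf[of E \<Phi>] continuous_on_subset[OF cont]
    by (metis compact_eq_bounded_closed empty_iff subset_UNIV)
  have "ereal (q (fst z)) + h (fst z) \<le> ereal (q y) + h y" for y
  proof (cases "h y")
    case (real s)
    have "\<Phi> z \<le> q y + s"
    proof (cases "q y + s \<le> \<alpha>")
      case True
      then show ?thesis
        using min[of "(y, s)"] real by (simp add: E_def ereal_epigraph_def \<Phi>_def)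
    next
      case False
      then show ?thesis
        using z by (simp add: E_def)
    qed
    have "h (fst z) \<le> ereal (snd z)"
      using z by (auto simp: E_def ereal_epigraph_def)
    then have "ereal (q (fst z)) + h (fst z) \<le> ereal (q (fst z)) + ereal (snd z)"
      by (rule add_left_mono)
    also have "\<dots> \<le> ereal (q y) + h y"
      using \<open>\<Phi> z \<le> q y + s\<close> real by (simp add: \<Phi>_def)
    finally show ?thesis .
  next
    case MInf
    then show ?thesis
      using lower[of y] by simp
  qed simp
  then show ?thesis
    by blast
qed

section \<open>The primal minimiser and the dual function\<close>

text \<open>
  A minimiser exists by coercivity, so the hypothesis on \<open>primal_argmin F C \<nu>\<close> is about a genuine one.
  The objective dominates a strictly convex quadratic with minimiser \<open>u\<close> and agrees with it on \<open>X\<close>.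
  A short step from the interior minimiser \<open>x\<close> of the objective towards \<open>u\<close> stays in \<open>X\<close>, where it
  would strictly decrease the quadratic unless \<open>x = u\<close>.
\<close>

lemma primal_argmin_interior:
  fixes H :: "real ^ 'n ^ 'n" and C :: "real ^ 'n ^ 'k" and h :: "real ^ 'n \<Rightarrow> ereal"
    and \<zeta> :: "real ^ 'n"
  defines "F \<equiv> \<lambda>x. ereal (1 / 2 * (x \<bullet> (H *v x)) + \<zeta> \<bullet> x) + h x"
  assumes H: "pos_def H" and "closed_fun h" and "convex_fun h"
    and aff: "\<And>x. x \<in> X \<Longrightarrow> h x = ereal (\<xi> \<bullet> x + \<theta>)"
    and int: "primal_argmin F C \<nu> \<in> interior X"
  shows "primal_argmin F C \<nu> = - (matrix_inv H *v (\<zeta> + \<xi> + transpose C *v \<nu>))"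
proof -
  let ?x = "primal_argmin F C \<nu>"
  define w where "w = \<zeta> + \<xi> + transpose C *v \<nu>"
  define u where "u = - (matrix_inv H *v w)"
  define q where "q = (\<lambda>x. 1 / 2 * (x \<bullet> (H *v x)) + \<zeta> \<bullet> x + \<nu> \<bullet> (C *v x))"
  have objective: "F x + ereal (\<nu> \<bullet> (C *v x)) = ereal (q x) + h x" for x
    by (cases "h x") (simp_all add: F_def q_def)
  have q_eq: "q x + (\<xi> \<bullet> x + \<theta>) = 1 / 2 * (x \<bullet> (H *v x)) + w \<bullet> x + \<theta>" for x
    by (simp add: q_def w_def inner_add_left inner_matrix_transpose[of \<nu> C])
  have lower: "ereal (\<xi> \<bullet> x + \<theta>) \<le> h x" for x
    using convex_fun_ge_affine[OF assms(4) int aff] .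
  have "h ?x \<noteq> \<infinity>"
    using aff[of ?x] int interior_subset[of X] by auto
  moreover have "bounded {x. q x + (\<xi> \<bullet> x + \<theta>) \<le> \<alpha>}" for \<alpha>
    using pos_def_sublevel_bounded[OF H, of w "\<alpha> - \<theta>"] by (simp add: q_eq le_diff_eq)
  moreover have "continuous_on UNIV q"
    unfolding q_def by (intro continuous_intros matrix_vector_mult_linear_continuous_on)
  moreover have "continuous_on UNIV (\<lambda>x. \<xi> \<bullet> x + \<theta>)"
    by (intro continuous_intros)
  ultimately obtain x where "\<And>y. ereal (q x) + h x \<le> ereal (q y) + h y"
    using closed_fun_attains_min[OF assms(3) _ _ lower] by blast
  then have "is_arg_min (\<lambda>x. F x + ereal (\<nu> \<bullet> (C *v x))) (\<lambda>_. True) x"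
    by (simp add: is_arg_min_def objective leD)
  then have "is_arg_min (\<lambda>x. F x + ereal (\<nu> \<bullet> (C *v x))) (\<lambda>_. True) ?x"
    unfolding primal_argmin_def arg_min_def by (rule someI)
  then have min: "ereal (q ?x) + h ?x \<le> ereal (q y) + h y" for y
    by (simp add: is_arg_min_def objective not_less)
  obtain t where t: "0 < t" "t < 1" "?x + t *\<^sub>R (u - ?x) \<in> X"
    using interior_small_step[OF int] .
  let ?v = "?x - u"
  have square: "q x + (\<xi> \<bullet> x + \<theta>)
      = 1 / 2 * ((x - u) \<bullet> (H *v (x - u))) - 1 / 2 * (w \<bullet> (matrix_inv H *v w)) + \<theta>" for x
    using complete_the_square[OF H, of x w] by (simp add: q_eq u_def)
  have "?x \<in> X"
    using int interior_subset[of X] by blast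
  then have "q ?x + (\<xi> \<bullet> ?x + \<theta>)
      \<le> q (?x + t *\<^sub>R (u - ?x)) + (\<xi> \<bullet> (?x + t *\<^sub>R (u - ?x)) + \<theta>)"
    using min[of "?x + t *\<^sub>R (u - ?x)"] aff[OF t(3)] aff[of ?x] by simp
  then have "?v \<bullet> (H *v ?v) \<le> (?x + t *\<^sub>R (u - ?x) - u) \<bullet> (H *v (?x + t *\<^sub>R (u - ?x) - u))"
    unfolding square by simp
  moreover have "?x + t *\<^sub>R (u - ?x) - u = (1 - t) *\<^sub>R ?v"
    by (simp add: algebra_simps)
  ultimately have "?v \<bullet> (H *v ?v) \<le> (1 - t)\<^sup>2 * (?v \<bullet> (H *v ?v))"
    by (simp add: matrix_vector_mult_scaleR power2_eq_square mult.assoc)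
  moreover have "(1 - t)\<^sup>2 < 1"
    using t by (simp add: power_less_one_iff)
  ultimately have "\<not> ?v \<bullet> (H *v ?v) > 0"
    by (smt (verit) mult_less_cancel_right2)
  then have "?v = 0"
    using H unfolding pos_def_def by blast
  then have "?x = u"
    by (rule right_minus_eq[THEN iffD1])
  then show ?thesis
    by (simp only: u_def w_def)
qed

text \<open>
  If the minimiser of the quadratic lower bound lies in \<open>X\<close>, it also minimises the objective,
  so the infimum defining the dual function is the minimum of the quadratic.
\<close>

lemma dual_fun_eq_quadratic:
  fixes H :: "real ^ 'n ^ 'n" and C :: "real ^ 'n ^ 'k" and h :: "real ^ 'n \<Rightarrow> ereal"
    and \<zeta> :: "real ^ 'n"
  defines "F \<equiv> \<lambda>x. ereal (1 / 2 * (x \<bullet> (H *v x)) + \<zeta> \<bullet> x) + h x"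
  assumes H: "pos_def H"
    and lower: "\<And>x. ereal (\<xi> \<bullet> x + \<theta>) \<le> h x"
    and aff: "\<And>x. x \<in> X \<Longrightarrow> h x = ereal (\<xi> \<bullet> x + \<theta>)"
    and w: "w = \<zeta> + \<xi> + transpose C *v \<nu>"
    and "- (matrix_inv H *v w) \<in> X"
  shows "dual_fun F C c \<nu> = ereal (\<theta> - 1 / 2 * (w \<bullet> (matrix_inv H *v w)) - c \<bullet> \<nu>)"
proof -
  define u where "u = - (matrix_inv H *v w)"
  define m where "m = \<theta> - 1 / 2 * (w \<bullet> (matrix_inv H *v w))"
  let ?y = "- (transpose C *v \<nu>)"
  have square: "1 / 2 * (x \<bullet> (H *v x)) + \<zeta> \<bullet> x + (\<xi> \<bullet> x + \<theta>) - ?y \<bullet> x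
      = m + 1 / 2 * ((x - u) \<bullet> (H *v (x - u)))" for x
    using complete_the_square[OF H, of x w] by (simp add: m_def u_def w inner_add_left)
  have "conjugate_fun F ?y = ereal (- m)"
    unfolding conjugate_fun_def
  proof (rule antisym)
    show "(SUP x. ereal (?y \<bullet> x) - F x) \<le> ereal (- m)"
    proof (rule SUP_least)
      fix x
      have "0 \<le> (x - u) \<bullet> (H *v (x - u))"
        using H by (cases "x - u = 0") (auto simp: pos_def_def less_imp_le)
      then have "?y \<bullet> x - (1 / 2 * (x \<bullet> (H *v x)) + \<zeta> \<bullet> x + (\<xi> \<bullet> x + \<theta>)) \<le> - m"
        using square[of x] by linarith
      then show "ereal (?y \<bullet> x) - F x \<le> ereal (- m)"
        using lower[of x] by (cases "h x") (auto simp: F_def)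
    qed
    have "ereal (- m) = ereal (?y \<bullet> u) - F u"
      using square[of u] aff[of u] assms(6) by (simp add: F_def u_def)
    then show "ereal (- m) \<le> (SUP x. ereal (?y \<bullet> x) - F x)"
      by (intro SUP_upper2[of u]) simp_all
  qed
  then show ?thesis
    by (simp add: dual_fun_def m_def)
qed

section \<open>The curvature of the dual function\<close>

text \<open>
  A gradient at \<open>\<nu>\<close> is a local notion, so the formula for \<open>d\<close> is required only near \<open>\<nu>\<close>; for
  the dual function it is available only while the minimiser of the quadratic stays in \<open>X\<close>.
\<close>

lemma quadratic_has_gradient:
  fixes C :: "real ^ 'n ^ 'k" and J :: "real ^ 'n ^ 'n"
  assumes "sym_mat J"
    and near: "\<forall>\<^sub>F z in nhds \<nu>. d z = ereal (\<theta> - 1 / 2 * ((a + transpose C *v z)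
       \<bullet> (J *v (a + transpose C *v z))) - c \<bullet> z)"
  shows "has_gradient d \<nu> (- (C *v (J *v (a + transpose C *v \<nu>))) - c)"
proof -
  define Q where "Q z = \<theta> - 1 / 2 * ((a + transpose C *v z)
       \<bullet> (J *v (a + transpose C *v z))) - c \<bullet> z" for z
  let ?g = "- (C *v (J *v (a + transpose C *v \<nu>))) - c"
  have "(Q has_derivative (\<lambda>v. v \<bullet> ?g)) (at \<nu>)"
    unfolding Q_def
  proof (rule has_derivative_eq_rhs)
    let ?w = "a + transpose C *v \<nu>"
    show "((\<lambda>z. \<theta> - 1 / 2 * ((a + transpose C *v z) \<bullet> (J *v (a + transpose C *v z))) - c \<bullet> z)
      has_derivative (\<lambda>v. 0 - 1 / 2 * (?w \<bullet> (J *v (0 + transpose C *v v))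
         + (0 + transpose C *v v) \<bullet> (J *v ?w)) - c \<bullet> v)) (at \<nu>)"
      by (intro derivative_intros bounded_linear.has_derivative[OF matrix_vector_mul_bounded_linear])
    show "(\<lambda>v. 0 - 1 / 2 * (?w \<bullet> (J *v (0 + transpose C *v v))
         + (0 + transpose C *v v) \<bullet> (J *v ?w)) - c \<bullet> v) = (\<lambda>v. v \<bullet> ?g)"
    proof
      fix v
      have "?w \<bullet> (J *v (transpose C *v v)) = (transpose C *v v) \<bullet> (J *v ?w)"
        using sym_mat_inner[OF assms(1), of ?w] by (simp add: inner_commute)
      then show "0 - 1 / 2 * (?w \<bullet> (J *v (0 + transpose C *v v))
         + (0 + transpose C *v v) \<bullet> (J *v ?w)) - c \<bullet> v = v \<bullet> ?g"
        using inner_matrix_transpose[of v C "J *v ?w"]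
        by (simp add: inner_diff_right inner_commute[of c])
    qed
  qed
  moreover have ev: "\<forall>\<^sub>F z in nhds \<nu>. real_of_ereal (d z) = Q z"
    using near by eventually_elim (simp add: Q_def)
  then have ev_at: "\<forall>\<^sub>F z in at \<nu>. Q z = real_of_ereal (d z)"
    by (auto simp: eventually_at_filter elim!: eventually_mono)
  moreover have "\<forall>\<^sub>F z in nhds \<nu>. \<bar>d z\<bar> \<noteq> \<infinity>"
    using near by eventually_elim simp
  ultimately show ?thesis
    unfolding has_gradient_def gderiv_def
    using ev_at eventually_nhds_x_imp_x[OF ev]
    by (auto intro: has_derivative_transform_eventually)
qed

theorem proposition13:
  fixes H :: "real ^ 'n ^ 'n" and \<zeta> :: "real ^ 'n"
    and f :: "real ^ 'n \<Rightarrow> real"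
    and h F :: "real ^ 'n \<Rightarrow> ereal"
    and A :: "real ^ 'n ^ 'm" and B :: "real ^ 'n ^ 'p" and b :: "real ^ 'm"
    and C :: "real ^ 'n ^ ('m + 'p)" and c :: "real ^ ('m + 'p)"
    and d :: "real ^ ('m + 'p) \<Rightarrow> ereal"
    and xstar :: "real ^ ('m + 'p) \<Rightarrow> real ^ 'n"
    and X :: "(real ^ 'n) set" and \<xi> :: "real ^ 'n" and \<theta> :: real
    and \<nu>t :: "real ^ ('m + 'p)"
    and L :: "real ^ ('m + 'p) ^ ('m + 'p)"
  defines "f \<equiv> \<lambda>x. 1 / 2 * (x \<bullet> (H *v x)) + \<zeta> \<bullet> x"
    and "F \<equiv> \<lambda>x. ereal (f x) + h x"
    and "C \<equiv> stack_mat A B"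
    and "c \<equiv> stack_vec b 0"
    and "d \<equiv> dual_fun F C c"
    and "xstar \<equiv> primal_argmin F C"
  assumes "pos_def H"
    and "proper_fun h" and "closed_fun h" and "convex_fun h"
    and "rank A = CARD('m)"
    and "interior X \<noteq> {}"
    and "\<forall>x\<in>X. h x = ereal (\<xi> \<bullet> x + \<theta>)"
    and "xstar \<nu>t \<in> interior X"
    and "sym_mat L"
    and "\<not> (L \<succeq> C ** matrix_inv H ** transpose C)"
  shows "\<exists>\<nu>1 \<nu>2. \<not> (d \<nu>1 \<ge> d \<nu>2
           + ereal (gradient d \<nu>2 \<bullet> (\<nu>1 - \<nu>2) - 1 / 2 * norm_sq_mat L (\<nu>1 - \<nu>2)))"
proof -
  define J where "J = matrix_inv H"
  define K where "K = C ** J ** transpose C"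
  define a where "a = \<zeta> + \<xi>"
  define w where "w \<nu> = a + transpose C *v \<nu>" for \<nu>
  define Q where "Q \<nu> = \<theta> - 1 / 2 * (w \<nu> \<bullet> (J *v w \<nu>)) - c \<bullet> \<nu>" for \<nu>
  define g where "g = - (C *v (J *v w \<nu>t)) - c"
  note H = \<open>pos_def H\<close>
  have J: "sym_mat J"
    unfolding J_def by (rule pos_def_inverse_sym[OF H])
  have aff: "\<And>x. x \<in> X \<Longrightarrow> h x = ereal (\<xi> \<bullet> x + \<theta>)"
    using assms by blast
  have F: "F = (\<lambda>x. ereal (1 / 2 * (x \<bullet> (H *v x)) + \<zeta> \<bullet> x) + h x)"
    by (simp add: F_def f_def)
  have "- (J *v w \<nu>t) \<in> interior X"
    using primal_argmin_interior[OF H \<open>closed_fun h\<close> \<open>convex_fun h\<close> aff,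
        where \<zeta> = \<zeta> and C = C and \<nu> = \<nu>t]
      \<open>xstar \<nu>t \<in> interior X\<close>
    by (simp add: xstar_def F J_def w_def a_def)
  moreover have "((\<lambda>\<nu>. - (J *v w \<nu>)) \<longlongrightarrow> - (J *v w \<nu>t)) (nhds \<nu>t)"
    unfolding w_def
    by (intro tendsto_intros bounded_linear.tendsto[OF matrix_vector_mul_bounded_linear])
      (simp add: filterlim_ident)
  ultimately have "\<forall>\<^sub>F \<nu> in nhds \<nu>t. - (J *v w \<nu>) \<in> interior X"
    by (rule topological_tendstoD[OF _ open_interior, rotated])
  then have near: "\<forall>\<^sub>F \<nu> in nhds \<nu>t. d \<nu> = ereal (Q \<nu>)"
  proof eventually_elim
    case (elim \<nu>)
    have "\<And>x. ereal (\<xi> \<bullet> x + \<theta>) \<le> h x"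
      using convex_fun_ge_affine[OF \<open>convex_fun h\<close> elim aff] .
    then show ?case
      using dual_fun_eq_quadratic[OF H _ aff, where w = "w \<nu>" and \<zeta> = \<zeta> and C = C and \<nu> = \<nu> and c = c]
        elim interior_subset[of X]
      by (auto simp: d_def F Q_def J_def w_def a_def)
  qed
  then have grad: "gradient d \<nu>t = g"
    unfolding g_def w_def Q_def by (intro gradient_eq quadratic_has_gradient J)
  \<comment> \<open>\<open>Q\<close> is a quadratic polynomial, so its second order expansion has no remainder.\<close>
  have expand: "Q (\<nu>t + v) = Q \<nu>t + g \<bullet> v - 1 / 2 * (v \<bullet> (K *v v))" for v
  proof -
    let ?s = "transpose C *v v"
    have "w (\<nu>t + v) = w \<nu>t + ?s"
      by (simp add: w_def matrix_vector_right_distrib)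
    moreover have "w \<nu>t \<bullet> (J *v ?s) = ?s \<bullet> (J *v w \<nu>t)"
      using sym_mat_inner[OF J, of "w \<nu>t" ?s] by (simp add: inner_commute)
    moreover have "v \<bullet> (K *v v) = ?s \<bullet> (J *v ?s)"
      by (simp add: K_def matrix_vector_mul_assoc[symmetric] inner_matrix_transpose[of v C])
    moreover have "g \<bullet> v = - (?s \<bullet> (J *v w \<nu>t)) - c \<bullet> v"
      using inner_matrix_transpose[of v C "J *v w \<nu>t"]
      by (simp add: g_def inner_diff_right inner_commute[of _ v])
    ultimately show ?thesis
      by (simp add: Q_def matrix_vector_right_distrib inner_add_left inner_add_right algebra_simps)
  qed
  have "sym_mat (L - K)"
  proof -
    have "transpose K = K"
      using J by (simp add: K_def sym_mat_def matrix_transpose_mul matrix_mul_assoc)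
    then show ?thesis
      using \<open>sym_mat L\<close> by (simp add: sym_mat_def transpose_def vec_eq_iff)
  qed
  then obtain v where "v \<bullet> ((L - K) *v v) < 0"
    using \<open>\<not> (L \<succeq> C ** matrix_inv H ** transpose C)\<close>
    by (auto simp: loewner_ge_def pos_semidef_def K_def J_def not_le)
  then have v: "v \<bullet> (L *v v) < v \<bullet> (K *v v)"
    by (simp add: matrix_vector_mult_diff_rdistrib inner_diff_right)
  have "((\<lambda>t. \<nu>t + t *\<^sub>R v) \<longlongrightarrow> \<nu>t + 0 *\<^sub>R v) (at_right (0::real))"
    by (intro tendsto_intros)
  then have "\<forall>\<^sub>F t in at_right (0::real). d (\<nu>t + t *\<^sub>R v) = ereal (Q (\<nu>t + t *\<^sub>R v))"
    using near by (auto simp: filterlim_iff)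
  then have "\<forall>\<^sub>F t in at_right (0::real). d (\<nu>t + t *\<^sub>R v) = ereal (Q (\<nu>t + t *\<^sub>R v)) \<and> 0 < t"
    using eventually_at_right_less by (rule eventually_conj)
  then obtain t where t: "t > 0" "d (\<nu>t + t *\<^sub>R v) = ereal (Q (\<nu>t + t *\<^sub>R v))"
    using eventually_happens trivial_limit_at_right_real by blast
  have "t\<^sup>2 * (v \<bullet> (L *v v)) < t\<^sup>2 * (v \<bullet> (K *v v))"
    using t(1) v by simp
  then have "Q (\<nu>t + t *\<^sub>R v) < Q \<nu>t + (g \<bullet> (t *\<^sub>R v) - 1 / 2 * norm_sq_mat L (t *\<^sub>R v))"
    by (simp add: expand norm_sq_mat_def matrix_vector_mult_scaleR power2_eq_square mult.assoc)
  then have "\<not> d (\<nu>t + t *\<^sub>R v) \<ge> d \<nu>t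
      + ereal (gradient d \<nu>t \<bullet> (\<nu>t + t *\<^sub>R v - \<nu>t) - 1 / 2 * norm_sq_mat L (\<nu>t + t *\<^sub>R v - \<nu>t))"
    using t(2) eventually_nhds_x_imp_x[OF near] by (simp add: grad)
  then show ?thesis
    by blast
qed

end
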